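(* Let $C_1,C_2,\dots,C_m$ be nonempty closed convex subsets of $\mathbb{R}^J$ such that $C:=\bigcap_{i=1}^m C_i$ is nonempty. Let $M>0$ and suppose there is an index $s\in\{1,2,\dots,m\}$ such that $C_s\subset B(0,M)$. Let $\phi:\mathbb{R}^J\to\mathbb{R}$ be a convex function. Let $\{\alpha_k\}_{k=0}^\infty\subset(0,1]$ satisfy $$\lim_{k\to\infty}\alpha_k=0\quad\text{and}\quad\sum_{k=0}^\infty\alpha_k=\infty,$$ and let $\varepsilon\in(0,1)$. Then there exist an integer $K$ and a real number $\bar L$ such that for any sequence $\{x^k\}_{k=0}^\infty$ generated by the string-averaging projected subgradient method (SA-PSM, with step sizes $\{\alpha_k\}$, as defined in the context) with $\{(\Omega_k,w_k)\}_{k=1}^\infty\subset\mathcal{M}_{\ast\ast}$, the inequalities $$d(x^k,SOL(\phi,C))\le\varepsilon\quad\text{and}\quad \phi(x^k)\le\inf\{\phi(z)\mid z\in SOL(\phi,C)\}+\varepsilon\bar L$$ hold for all integers $k\ge K$.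
   Context: $m$ and $J$ are natural numbers, $\mathbb{R}^J$ carries the Euclidean norm $\|\cdot\|$, $B(x,r)=\{y\mid \|x-y\|\le r\}$, and $d(x,E)=\inf\{\|x-y\|\mid y\in E\}$ for nonempty $E$. $P_i$ denotes the metric (orthogonal) projection onto $C_i$. $\partial\phi(x)$ is the subdifferential of $\phi$ at $x$. The solution set is $SOL(\phi,C):=\{x\in C\mid \phi(x)\le\phi(y)\text{ for all }y\in C\}$. An index vector is a vector $t=(t_1,\dots,t_q)$ with $q\ge 1$ and all $t_i\in\{1,\dots,m\}$; its length is $\ell(t)=q$, and $P[t]:=P_{t_q}P_{t_{q-1}}\cdots P_{t_1}$. A finite set $\Omega$ of index vectors (of possibly different lengths) is called fit if for each $i\in\{1,\dots,m\}$ there is $t=(t_1,\dots,t_q)\in\Omega$ with $t_s=i$ for some $s$. $\mathcal{M}$ is the collection of all pairs $(\Omega,w)$ where $\Omega$ is a fit finite set of index vectors and $w:\Omega\to(0,\infty)$ satisfies $\sum_{t\in\Omega}w(t)=1$. For $(\Omega,w)\in\mathcal{M}$, put $P_{\Omega,w}(x):=\sum_{t\in\Omega}w(t)P[t](x)$. Fix a number $\Delta\in(0,1/m)$ and an integer $\bar q\ge m$. $\mathcal{M}_{\ast}$ is the set of all $(\Omega,w)\in\mathcal{M}$ such that $\ell(t)\le\bar q$ and $w(t)\ge\Delta$ for all $t\in\Omega$. $\mathcal{M}_{\ast\ast}$ is the set of all $(\Omega,w)\in\mathcal{M}_\ast$ such that $\Omega$ is $M$-fit, i.e. $\Omega$ is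 fit and for each $t=(t_1,\dots,t_{\ell(t)})\in\Omega$ there is $u\in\{1,\dots,\ell(t)\}$ with $C_{t_u}\subset B(0,M)$, where $M$ is the constant in the claim. String-averaging projected subgradient method (SA-PSM): given $\{\alpha_k\}_{k=0}^\infty\subset(0,1]$, select an arbitrary $x^0\in\mathbb{R}^J$. For each $k\ge0$, given $x^k$, pick a pair $(\Omega_k,w_k)\in\mathcal{M}_\ast$ and proceed as follows. If $0\in\partial\phi(x^k)$, set $x^{k+1}=P_{\Omega_k,w_k}(x^k)$. If $0\notin\partial\phi(x^k)$, choose any $s^k\in\partial\phi(x^k)$ and set $$x^{k+1}=P_{\Omega_k,w_k}\left(x^k-\alpha_k\frac{s^k}{\|s^k\|}\right).$$ *)

theory Defs
  imports "HOL-Analysis.Analysis"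
begin

definition subdifferential :: "('a::real_inner \<Rightarrow> real) \<Rightarrow> 'a \<Rightarrow> 'a set" where
  "subdifferential \<phi> x = {l. \<forall>y. l \<bullet> (y - x) \<le> \<phi> y - \<phi> x}"

definition SOL :: "('a \<Rightarrow> real) \<Rightarrow> 'a set \<Rightarrow> 'a set" where
  "SOL \<phi> C = {x \<in> C. \<forall>y\<in>C. \<phi> x \<le> \<phi> y}"

definition index_vector :: "nat \<Rightarrow> nat list \<Rightarrow> bool" where
  "index_vector m t \<longleftrightarrow> t \<noteq> [] \<and> set t \<subseteq> {1..m}"

(* The head of the list acts first: for t = [t_1, ..., t_q] this is P_{t_q} ... P_{t_1}. *)
definition string_proj :: "(nat \<Rightarrow> 'a::euclidean_space set) \<Rightarrow> nat list \<Rightarrow> 'a \<Rightarrow> 'a" where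
  "string_proj C t x = fold (\<lambda>i y. closest_point (C i) y) t x"

definition fit :: "nat \<Rightarrow> nat list set \<Rightarrow> bool" where
  "fit m \<Omega> \<longleftrightarrow> finite \<Omega> \<and> (\<forall>t\<in>\<Omega>. index_vector m t) \<and> (\<forall>i\<in>{1..m}. \<exists>t\<in>\<Omega>. i \<in> set t)"

(* A weight is a total function on lists; only its values on \<Omega> matter. *)
definition weighted_strings :: "nat \<Rightarrow> (nat list set \<times> (nat list \<Rightarrow> real)) set" where
  "weighted_strings m =
     {(\<Omega>, w). fit m \<Omega> \<and> (\<forall>t\<in>\<Omega>. 0 < w t) \<and> (\<Sum>t\<in>\<Omega>. w t) = 1}"

definition string_average ::
    "(nat \<Rightarrow> 'a::euclidean_space set) \<Rightarrow> nat list set \<Rightarrow> (nat list \<Rightarrow> real) \<Rightarrow> 'a \<Rightarrow> 'a" where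
  "string_average C \<Omega> w x = (\<Sum>t\<in>\<Omega>. w t *\<^sub>R string_proj C t x)"

definition M_star :: "nat \<Rightarrow> real \<Rightarrow> nat \<Rightarrow> (nat list set \<times> (nat list \<Rightarrow> real)) set" where
  "M_star m \<Delta> qbar =
     {(\<Omega>, w) \<in> weighted_strings m. \<forall>t\<in>\<Omega>. length t \<le> qbar \<and> \<Delta> \<le> w t}"

definition M_fit ::
    "(nat \<Rightarrow> 'a::euclidean_space set) \<Rightarrow> nat \<Rightarrow> real \<Rightarrow> nat list set \<Rightarrow> bool" where
  "M_fit C m M \<Omega> \<longleftrightarrow> fit m \<Omega> \<and> (\<forall>t\<in>\<Omega>. \<exists>i\<in>set t. C i \<subseteq> cball 0 M)"

definition M_star_star ::
    "(nat \<Rightarrow> 'a::euclidean_space set) \<Rightarrow> nat \<Rightarrow> real \<Rightarrow> real \<Rightarrow> nat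
      \<Rightarrow> (nat list set \<times> (nat list \<Rightarrow> real)) set" where
  "M_star_star C m M \<Delta> qbar = {(\<Omega>, w) \<in> M_star m \<Delta> qbar. M_fit C m M \<Omega>}"

definition SA_PSM ::
    "(nat \<Rightarrow> 'a::euclidean_space set) \<Rightarrow> nat \<Rightarrow> real \<Rightarrow> nat \<Rightarrow> ('a \<Rightarrow> real) \<Rightarrow> (nat \<Rightarrow> real)
      \<Rightarrow> (nat \<Rightarrow> nat list set) \<Rightarrow> (nat \<Rightarrow> nat list \<Rightarrow> real) \<Rightarrow> (nat \<Rightarrow> 'a) \<Rightarrow> bool" where
  "SA_PSM C m \<Delta> qbar \<phi> \<alpha> \<Omega> w x \<longleftrightarrow>
     (\<forall>k. (\<Omega> k, w k) \<in> M_star m \<Delta> qbar \<and>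
          (if 0 \<in> subdifferential \<phi> (x k)
           then x (Suc k) = string_average C (\<Omega> k) (w k) (x k)
           else \<exists>s \<in> subdifferential \<phi> (x k).
                  x (Suc k) =
                    string_average C (\<Omega> k) (w k) (x k - \<alpha> k *\<^sub>R (s /\<^sub>R norm s))))"

end

theory Submission
  imports Defs
begin

text \<open>
  Let \<open>D\<close> be the intersection of the \<open>C i\<close> and \<open>S\<close> the solution set. From \<open>k = 2\<close> on the iterates lie in a fixed ball, because
  every string passes through some \<open>C i \<subseteq> cball 0 M\<close> and projections do not increase the
  distance to a point of \<open>D\<close>. If \<open>x k\<close> is at distance at least \<open>\<epsilon> / 2\<close> from \<open>S\<close>, then by compactness
  it is either bounded away from \<open>D\<close>, and the averaged projections decrease the squared distance
  to every point of \<open>S\<close> by a fixed amount, or \<open>\<phi> (x k)\<close> exceeds the minimum by a fixed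
  amount, and the subgradient step decreases it. For small steps either decrease is at least
  \<open>c * \<alpha> k\<close>. Otherwise the distance grows by at most \<open>\<alpha> k \<le> \<epsilon> / 2\<close>. As the \<open>\<alpha> k\<close> have a divergent
  sum, the iterates come within \<open>\<epsilon>\<close> of \<open>S\<close> after a uniformly bounded number of steps and stay there.
  The estimate of the objective, with \<open>L = 1\<close>, follows by applying this to a smaller distance given by
  the uniform continuity of \<open>\<phi>\<close>.
\<close>

section \<open>Projections and strings of projections\<close>

text \<open>The directions from the projection to \<open>x\<close> and to \<open>z\<close> have
  nonpositive inner product; expanding the squares gives the claim.\<close>

lemma dist_closest_point_Pythagoras:
  fixes S :: "'a::euclidean_space set"
  assumes "convex S" "closed S" "z \<in> S"
  shows "(dist (closest_point S x) z)\<^sup>2 + (dist x (closest_point S x))\<^sup>2 \<le> (dist x z)\<^sup>2"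
proof -
  have "(x - closest_point S x) \<bullet> (z - closest_point S x) \<le> 0"
    using assms by (intro closest_point_dot)
  then show ?thesis
    by (simp add: dist_norm power2_norm_eq_inner inner_diff_left inner_diff_right inner_commute)
qed

lemma string_proj_Nil [simp]: "string_proj C [] x = x"
  by (simp add: string_proj_def)

lemma string_proj_Cons [simp]:
  "string_proj C (i # t) x = string_proj C t (closest_point (C i) x)"
  by (simp add: string_proj_def)

lemma string_proj_append:
  "string_proj C (s @ t) x = string_proj C t (string_proj C s x)"
  by (simp add: string_proj_def)

lemma dist_string_proj_le:
  fixes C :: "nat \<Rightarrow> 'a::euclidean_space set"
  assumes "\<And>i. i \<in> set t \<Longrightarrow> convex (C i) \<and> closed (C i) \<and> z \<in> C i"
  shows "dist (string_proj C t x) z \<le> dist x z"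
  using assms
proof (induction t arbitrary: x)
  case (Cons i t)
  have "(dist (closest_point (C i) x) z)\<^sup>2 \<le> (dist x z)\<^sup>2"
    using dist_closest_point_Pythagoras[of "C i" z x] Cons.prems[of i]
    by (smt (verit) list.set_intros(1) zero_le_power2)
  then have "dist (closest_point (C i) x) z \<le> dist x z"
    by (rule power2_le_imp_le) simp
  moreover have "dist (string_proj C (i # t) x) z \<le> dist (closest_point (C i) x) z"
    using Cons by simp
  ultimately show ?case by linarith
qed simp

text \<open>Cauchy-Schwarz with weights \<open>1\<close> and \<open>n\<close>. It lets the divisor
  grow by one for each further projection of a string.\<close>

lemma square_add_div_Suc_le:
  fixes a b :: real
  assumes "0 < n"
  shows "(a + b)\<^sup>2 / (n + 1) \<le> a\<^sup>2 + b\<^sup>2 / n"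
proof -
  have "0 \<le> (n * a - b)\<^sup>2" by simp
  then have "n * (a + b)\<^sup>2 \<le> (n + 1) * (n * a\<^sup>2 + b\<^sup>2)"
    by (simp add: power2_eq_square algebra_simps)
  then show ?thesis
    using assms by (simp add: field_simps)
qed

text \<open>Each projection lowers the squared distance to \<open>z\<close> by at least the square
  of its displacement. The displacements up to the last projection onto \<open>C i\<close> form a
  path from \<open>x\<close> to \<open>C i\<close>, so they add up to at least
  \<open>infdist x (C i)\<close>; Cauchy-Schwarz over at most \<open>length t\<close> of them gives
  the divisor.\<close>

lemma string_proj_Fejer:
  fixes C :: "nat \<Rightarrow> 'a::euclidean_space set"
  assumes "\<And>i. i \<in> set t \<Longrightarrow> convex (C i) \<and> closed (C i) \<and> z \<in> C i" and "i \<in> set t"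
  shows "(dist (string_proj C t x) z)\<^sup>2 + (infdist x (C i))\<^sup>2 / real (length t) \<le> (dist x z)\<^sup>2"
  using assms
proof (induction t arbitrary: x)
  case (Cons j t)
  define y where "y = closest_point (C j) x"
  have y: "(dist y z)\<^sup>2 + (dist x y)\<^sup>2 \<le> (dist x z)\<^sup>2"
    unfolding y_def using Cons.prems(1)[of j] by (intro dist_closest_point_Pythagoras) auto
  show ?case
  proof (cases "i \<in> set t")
    case True
    then have pos: "0 < real (length t)" by (cases t) auto
    have IH: "(dist (string_proj C t y) z)\<^sup>2 + (infdist y (C i))\<^sup>2 / real (length t) \<le> (dist y z)\<^sup>2"
      using Cons True by simp
    have "infdist x (C i) \<le> dist x y + infdist y (C i)"
      using infdist_triangle[of x "C i" y] by simp
    then have "(infdist x (C i))\<^sup>2 \<le> (dist x y + infdist y (C i))\<^sup>2"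
      by (intro power_mono infdist_nonneg)
    then have "(infdist x (C i))\<^sup>2 / real (length (j # t))
        \<le> (dist x y + infdist y (C i))\<^sup>2 / (real (length t) + 1)"
      by (simp add: divide_right_mono add.commute)
    also have "\<dots> \<le> (dist x y)\<^sup>2 + (infdist y (C i))\<^sup>2 / real (length t)"
      using pos by (rule square_add_div_Suc_le)
    finally show ?thesis
      using IH y by (simp add: y_def)
  next
    case False
    then have [simp]: "j = i" using Cons.prems by simp
    have "closed (C i)" "C i \<noteq> {}" using Cons.prems(1)[of i] by auto
    then have "y \<in> C i"
      by (simp add: y_def closest_point_in_set)
    then have "(infdist x (C i))\<^sup>2 \<le> (dist x y)\<^sup>2"
      by (intro power_mono infdist_le infdist_nonneg)
    moreover have "(infdist x (C i))\<^sup>2 / real (length (j # t)) \<le> (infdist x (C i))\<^sup>2"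
      using mult_left_mono[of 1 "real (length (j # t))" "(infdist x (C i))\<^sup>2"]
      by (simp add: divide_le_eq)
    moreover have "(dist (string_proj C t y) z)\<^sup>2 \<le> (dist y z)\<^sup>2"
      using Cons.prems by (intro power_mono dist_string_proj_le) auto
    ultimately show ?thesis
      using y unfolding string_proj_Cons y_def by linarith
  qed
qed simp

section \<open>String averages\<close>

text \<open>Jensen's inequality with the weights \<open>w\<close>, first for the norm and then for
  the square.\<close>

lemma power2_dist_string_average_le:
  assumes "(\<Omega>, w) \<in> weighted_strings m"
  shows "(dist (string_average C \<Omega> w x) z)\<^sup>2 \<le> (\<Sum>t\<in>\<Omega>. w t * (dist (string_proj C t x) z)\<^sup>2)"
proof -
  have w: "finite \<Omega>" "\<And>t. t \<in> \<Omega> \<Longrightarrow> 0 \<le> w t" "sum w \<Omega> = 1"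
    using assms by (auto simp: weighted_strings_def fit_def intro: less_imp_le)
  then have "\<Omega> \<noteq> {}" by auto
  have "string_average C \<Omega> w x - z = (\<Sum>t\<in>\<Omega>. w t *\<^sub>R (string_proj C t x - z))"
    using w by (simp add: string_average_def scaleR_right_diff_distrib sum_subtractf
        flip: scaleR_left.sum)
  then have "dist (string_average C \<Omega> w x) z \<le> (\<Sum>t\<in>\<Omega>. w t * dist (string_proj C t x) z)"
    by (auto simp: dist_norm w intro!: sum_norm_le)
  then have "(dist (string_average C \<Omega> w x) z)\<^sup>2 \<le> (\<Sum>t\<in>\<Omega>. w t * dist (string_proj C t x) z)\<^sup>2"
    by (intro power_mono) auto
  also have "\<dots> \<le> (\<Sum>t\<in>\<Omega>. w t * (dist (string_proj C t x) z)\<^sup>2)"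
    using convex_on_sum[OF w(1) \<open>\<Omega> \<noteq> {}\<close> convex_power2 w(3), of "\<lambda>t. dist (string_proj C t x) z"] w
    by simp
  finally show ?thesis .
qed

text \<open>By fitness some string \<open>u\<close> passes through \<open>i\<close>. Its gain counts
  with weight at least \<open>\<Delta>\<close> and divisor at most \<open>q\<close>, while the other
  strings do not move away from \<open>z\<close>.\<close>

lemma string_average_Fejer:
  fixes C :: "nat \<Rightarrow> 'a::euclidean_space set"
  assumes C: "\<And>i. i \<in> {1..m} \<Longrightarrow> convex (C i) \<and> closed (C i) \<and> z \<in> C i"
    and \<Omega>: "(\<Omega>, w) \<in> M_star m \<Delta> q" and "0 < \<Delta>" and i: "i \<in> {1..m}"
  shows "(dist (string_average C \<Omega> w x) z)\<^sup>2 + \<Delta> * (infdist x (C i))\<^sup>2 / real q \<le> (dist x z)\<^sup>2"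
proof -
  have W: "(\<Omega>, w) \<in> weighted_strings m"
    and len: "\<And>t. t \<in> \<Omega> \<Longrightarrow> length t \<le> q" and \<Delta>: "\<And>t. t \<in> \<Omega> \<Longrightarrow> \<Delta> \<le> w t"
    using \<Omega> by (auto simp: M_star_def)
  have fin: "finite \<Omega>" and wpos: "\<And>t. t \<in> \<Omega> \<Longrightarrow> 0 \<le> w t" and w1: "sum w \<Omega> = 1"
    and sub: "\<And>t. t \<in> \<Omega> \<Longrightarrow> set t \<subseteq> {1..m}"
    using W by (auto simp: weighted_strings_def fit_def index_vector_def intro: less_imp_le)
  obtain u where u: "u \<in> \<Omega>" "i \<in> set u"
    using W i unfolding weighted_strings_def fit_def by blast
  let ?e = "\<lambda>t. if t = u then (infdist x (C i))\<^sup>2 / real q else 0"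
  have bound: "(dist (string_proj C t x) z)\<^sup>2 + ?e t \<le> (dist x z)\<^sup>2" if "t \<in> \<Omega>" for t
  proof (cases "t = u")
    case True
    have "0 < length u" using u by (cases u) auto
    moreover from this have "0 < q" using len[OF u(1)] by linarith
    ultimately have "(infdist x (C i))\<^sup>2 / real q \<le> (infdist x (C i))\<^sup>2 / real (length u)"
      using len[OF u(1)] by (intro divide_left_mono mult_pos_pos) auto
    then show ?thesis
      using string_proj_Fejer[of u C z i x] C sub[OF u(1)] u(2) True by force
  next
    case False
    then show ?thesis
      using dist_string_proj_le[of t C z x] C sub[OF that] by (force intro: power_mono)
  qed
  have "\<Delta> * (infdist x (C i))\<^sup>2 / real q \<le> w u * ((infdist x (C i))\<^sup>2 / real q)"
    using mult_right_mono[OF \<Delta>[OF u(1)], of "(infdist x (C i))\<^sup>2 / real q"] by simp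
  also have "\<dots> = (\<Sum>t\<in>\<Omega>. w t * ?e t)"
    using fin u(1) by (simp add: if_distrib cong: if_cong)
  finally have "(dist (string_average C \<Omega> w x) z)\<^sup>2 + \<Delta> * (infdist x (C i))\<^sup>2 / real q
      \<le> (\<Sum>t\<in>\<Omega>. w t * ((dist (string_proj C t x) z)\<^sup>2 + ?e t))"
    using power2_dist_string_average_le[OF W, of C x z]
    by (simp only: distrib_left sum.distrib)
  also have "\<dots> \<le> (\<Sum>t\<in>\<Omega>. w t * (dist x z)\<^sup>2)"
    using bound wpos by (intro sum_mono mult_left_mono) auto
  also have "\<dots> = (dist x z)\<^sup>2"
    using w1 by (simp flip: sum_distrib_right)
  finally show ?thesis .
qed

text \<open>The projection onto a set inside \<open>cball 0 M\<close> lands within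
  \<open>2 * M\<close> of \<open>z\<close> wherever it starts, and the rest of the string does not
  move away from \<open>z\<close>. The bound is free of \<open>x\<close>, which is what makes the
  final index independent of the starting point.\<close>

lemma dist_string_average_M_fit_le:
  fixes C :: "nat \<Rightarrow> 'a::euclidean_space set"
  assumes C: "\<And>i. i \<in> {1..m} \<Longrightarrow> convex (C i) \<and> closed (C i) \<and> z \<in> C i"
    and \<Omega>: "(\<Omega>, w) \<in> M_star_star C m M \<Delta> q" and z: "norm z \<le> M"
  shows "dist (string_average C \<Omega> w x) z \<le> 2 * M"
proof -
  have W: "(\<Omega>, w) \<in> weighted_strings m" and fit: "M_fit C m M \<Omega>"
    using \<Omega> by (auto simp: M_star_star_def M_star_def)
  have wpos: "\<And>t. t \<in> \<Omega> \<Longrightarrow> 0 \<le> w t" and w1: "sum w \<Omega> = 1"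
    and sub: "\<And>t. t \<in> \<Omega> \<Longrightarrow> set t \<subseteq> {1..m}"
    using W by (auto simp: weighted_strings_def fit_def index_vector_def intro: less_imp_le)
  have "dist (string_proj C t x) z \<le> 2 * M" if t: "t \<in> \<Omega>" for t
  proof -
    obtain i where i: "i \<in> set t" "C i \<subseteq> cball 0 M"
      using fit t by (auto simp: M_fit_def)
    then obtain us vs where uv: "t = us @ i # vs"
      by (meson split_list)
    define y where "y = closest_point (C i) (string_proj C us x)"
    have "i \<in> {1..m}" using i sub[OF t] by auto
    then have "y \<in> C i"
      unfolding y_def using C[of i] by (intro closest_point_in_set) auto
    then have "norm y \<le> M" using i by (auto simp: dist_norm)
    have "dist (string_proj C t x) z = dist (string_proj C vs y) z"
      by (simp add: uv y_def string_proj_append)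
    also have "\<dots> \<le> dist y z"
      using C sub[OF t] by (intro dist_string_proj_le) (auto simp: uv)
    also have "\<dots> \<le> 2 * M"
      using \<open>norm y \<le> M\<close> z norm_triangle_ineq4[of y z] by (simp add: dist_norm)
    finally show ?thesis .
  qed
  then have "(\<Sum>t\<in>\<Omega>. w t * (dist (string_proj C t x) z)\<^sup>2) \<le> (\<Sum>t\<in>\<Omega>. w t * (2 * M)\<^sup>2)"
    using wpos by (intro sum_mono mult_left_mono power_mono) auto
  also have "\<dots> = (2 * M)\<^sup>2"
    using w1 by (simp flip: sum_distrib_right)
  finally have "(dist (string_average C \<Omega> w x) z)\<^sup>2 \<le> (2 * M)\<^sup>2"
    using power2_dist_string_average_le[OF W, of C x z] by linarith
  moreover have "0 \<le> M" using z norm_ge_zero[of z] by linarith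
  ultimately show ?thesis by (auto intro: power2_le_imp_le)
qed

section \<open>Uniform bounds for the decrease in one step\<close>

text \<open>Turns pointwise positivity into constants valid for all iterates. The empty set is
  included because there may be no points far from the target set.\<close>

lemma compact_continuous_pos_bounded_below:
  fixes g :: "'a::topological_space \<Rightarrow> real"
  assumes "compact X" "continuous_on X g" "\<And>x. x \<in> X \<Longrightarrow> 0 < g x"
  shows "\<exists>\<mu>>0. \<forall>x\<in>X. \<mu> \<le> g x"
proof (cases "X = {}")
  case True
  then show ?thesis by (intro exI[of _ 1]) simp
next
  case False
  then obtain x where "x \<in> X" "\<forall>y\<in>X. g x \<le> g y"
    using continuous_attains_inf assms(1,2) by blast
  then show ?thesis using assms(3) by blast
qed

lemma compact_infdist_ge:
  fixes X :: "'a::metric_space set"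
  assumes "compact X"
  shows "compact {x \<in> X. \<eta> \<le> infdist x S}"
proof -
  have "closed {x. \<eta> \<le> infdist x S}"
    by (intro closed_Collect_le continuous_intros)
  then have "compact (X \<inter> {x. \<eta> \<le> infdist x S})"
    using assms by blast
  then show ?thesis by (simp add: Int_def)
qed

text \<open>Summing the gains of \<open>string_average_Fejer\<close> over all \<open>i\<close> gives
  a continuous function \<open>?g\<close> that is positive off the intersection, hence bounded below
  on the compact set of points at distance at least \<open>\<eta>\<close> from it. This bound
  involves neither \<open>\<Omega>\<close>, \<open>w\<close> nor \<open>z\<close>.\<close>

lemma string_average_decrease:
  fixes C :: "nat \<Rightarrow> 'a::euclidean_space set"
  assumes C: "\<And>i. i \<in> {1..m} \<Longrightarrow> convex (C i) \<and> closed (C i)"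
    and ne: "(\<Inter>i\<in>{1..m}. C i) \<noteq> {}"
    and "0 < \<Delta>" "0 < q" "0 < m" and "compact X" and "0 < \<eta>"
  obtains \<gamma> where "0 < \<gamma>"
    and "\<And>\<Omega> w x z. \<lbrakk>(\<Omega>, w) \<in> M_star m \<Delta> q; x \<in> X; z \<in> (\<Inter>i\<in>{1..m}. C i);
          \<eta> \<le> infdist x (\<Inter>i\<in>{1..m}. C i)\<rbrakk>
        \<Longrightarrow> (dist (string_average C \<Omega> w x) z)\<^sup>2 + \<gamma> \<le> (dist x z)\<^sup>2"
proof -
  let ?D = "\<Inter>i\<in>{1..m}. C i"
  let ?g = "\<lambda>x. \<Sum>i=1..m. \<Delta> * (infdist x (C i))\<^sup>2 / real q"
  have term_nonneg: "0 \<le> \<Delta> * (infdist x (C i))\<^sup>2 / real q" for x i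
    using \<open>0 < \<Delta>\<close> by simp
  have "\<exists>\<mu>>0. \<forall>x\<in>{x \<in> X. \<eta> \<le> infdist x ?D}. \<mu> \<le> ?g x"
  proof (rule compact_continuous_pos_bounded_below)
    show "compact {x \<in> X. \<eta> \<le> infdist x ?D}"
      using \<open>compact X\<close> by (rule compact_infdist_ge)
    show "continuous_on {x \<in> X. \<eta> \<le> infdist x ?D} ?g"
      using \<open>0 < q\<close> by (intro continuous_intros) auto
    fix x assume x: "x \<in> {x \<in> X. \<eta> \<le> infdist x ?D}"
    then have "x \<notin> ?D" using \<open>0 < \<eta>\<close> infdist_zero[of x ?D] by force
    then obtain i where i: "i \<in> {1..m}" "x \<notin> C i" by blast
    \<comment> \<open>\<open>infdist\<close> to the empty set is 0 by default, so positivity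
      requires a nonempty set.\<close>
    moreover have "C i \<noteq> {}" using ne i(1) by blast
    ultimately have "0 < infdist x (C i)"
      using C[of i] infdist_pos_not_in_closed by blast
    then have "0 < \<Delta> * (infdist x (C i))\<^sup>2 / real q"
      using assms by simp
    also have "\<dots> \<le> ?g x"
      using i term_nonneg by (intro member_le_sum) auto
    finally show "0 < ?g x" .
  qed
  then obtain \<mu> where \<mu>: "0 < \<mu>" "\<And>x. \<lbrakk>x \<in> X; \<eta> \<le> infdist x ?D\<rbrakk> \<Longrightarrow> \<mu> \<le> ?g x"
    by blast
  show ?thesis
  \<comment> \<open>Each of the \<open>m\<close> terms of \<open>?g\<close> is at most the actual
    decrease, hence the divisor.\<close>
  proof (rule that[of "\<mu> / real m"])
    show "0 < \<mu> / real m" using \<mu> assms by simp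
    fix \<Omega> w x z
    assume *: "(\<Omega>, w) \<in> M_star m \<Delta> q" "x \<in> X" "z \<in> ?D" "\<eta> \<le> infdist x ?D"
    have "\<mu> \<le> ?g x" using \<mu>(2)[OF *(2,4)] .
    also have "\<dots> \<le> (\<Sum>i=1..m. (dist x z)\<^sup>2 - (dist (string_average C \<Omega> w x) z)\<^sup>2)"
    proof (rule sum_mono)
      fix i assume "i \<in> {1..m}"
      then show "\<Delta> * (infdist x (C i))\<^sup>2 / real q
          \<le> (dist x z)\<^sup>2 - (dist (string_average C \<Omega> w x) z)\<^sup>2"
        using string_average_Fejer[of m C z \<Omega> w \<Delta> q i x] C * \<open>0 < \<Delta>\<close> by auto
    qed
    finally have "\<mu> \<le> real m * ((dist x z)\<^sup>2 - (dist (string_average C \<Omega> w x) z)\<^sup>2)"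
      by simp
    then show "(dist (string_average C \<Omega> w x) z)\<^sup>2 + \<mu> / real m \<le> (dist x z)\<^sup>2"
      using \<open>0 < m\<close> by (simp add: field_simps)
  qed
qed

text \<open>A point of \<open>D\<close> whose value does not exceed the minimum
  \<open>\<phi> z\<close> is a solution. So the maximum \<open>?g\<close> of infeasibility and
  excess value is positive away from the solution set, and compactness bounds it below.\<close>

lemma SOL_dist_dichotomy:
  fixes D X :: "'a::metric_space set" and \<phi> :: "'a \<Rightarrow> real"
  assumes "compact X" "closed D" "continuous_on X \<phi>" "z \<in> SOL \<phi> D" "0 < \<epsilon>"
  obtains \<eta> where "0 < \<eta>"
    and "\<And>x. \<lbrakk>x \<in> X; \<epsilon> \<le> infdist x (SOL \<phi> D)\<rbrakk> \<Longrightarrow> \<eta> \<le> infdist x D \<or> \<phi> z + \<eta> \<le> \<phi> x"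
proof -
  let ?X = "{x \<in> X. \<epsilon> \<le> infdist x (SOL \<phi> D)}"
  let ?g = "\<lambda>x. max (infdist x D) (\<phi> x - \<phi> z)"
  have "\<exists>\<mu>>0. \<forall>x\<in>?X. \<mu> \<le> ?g x"
  proof (rule compact_continuous_pos_bounded_below)
    show "compact ?X" using assms by (intro compact_infdist_ge)
    show "continuous_on ?X ?g"
      by (intro continuous_intros continuous_on_subset[OF assms(3)]) auto
    fix x assume x: "x \<in> ?X"
    show "0 < ?g x"
    proof (rule ccontr)
      assume "\<not> 0 < ?g x"
      then have "infdist x D \<le> 0" "\<phi> x \<le> \<phi> z" by auto
      moreover have "D \<noteq> {}" using assms by (auto simp: SOL_def)
      ultimately have "x \<in> D"
        using \<open>closed D\<close> in_closed_iff_infdist_zero infdist_nonneg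
        by (metis order_antisym_conv)
      then have "x \<in> SOL \<phi> D"
        using \<open>\<phi> x \<le> \<phi> z\<close> \<open>z \<in> SOL \<phi> D\<close> by (force simp: SOL_def)
      then show False using x \<open>0 < \<epsilon>\<close> by simp
    qed
  qed
  then obtain \<mu> where \<mu>: "0 < \<mu>" "\<And>x. x \<in> ?X \<Longrightarrow> \<mu> \<le> ?g x"
    by blast
  show ?thesis
  proof (rule that[OF \<mu>(1)])
    fix x assume "x \<in> X" "\<epsilon> \<le> infdist x (SOL \<phi> D)"
    then have "\<mu> \<le> ?g x" using \<mu>(2) by blast
    then show "\<mu> \<le> infdist x D \<or> \<phi> z + \<mu> \<le> \<phi> x" by linarith
  qed
qed

text \<open>Moving from \<open>z\<close> by \<open>r\<close> in the direction of \<open>s\<close> stays inside the sublevel set of \<open>x\<close>,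
  so the subgradient inequality at that point yields \<open>r * norm s \<le> s \<bullet> (x - z)\<close>.\<close>
lemma dist_subgradient_step_le:
  fixes \<phi> :: "'a::real_inner \<Rightarrow> real"
  assumes s: "s \<in> subdifferential \<phi> x" "s \<noteq> 0" and "0 \<le> a" "0 \<le> r"
    and le: "\<And>y. dist y z \<le> r \<Longrightarrow> \<phi> y \<le> \<phi> x"
  shows "(dist (x - a *\<^sub>R (s /\<^sub>R norm s)) z)\<^sup>2 \<le> (dist x z)\<^sup>2 - 2 * a * r + a\<^sup>2"
proof -
  define u where "u = s /\<^sub>R norm s"
  have u: "norm u = 1" using s by (simp add: u_def)
  have "s \<bullet> (z + r *\<^sub>R u - x) \<le> \<phi> (z + r *\<^sub>R u) - \<phi> x"
    using s by (simp add: subdifferential_def)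
  also have "\<dots> \<le> 0"
    using le[of "z + r *\<^sub>R u"] u \<open>0 \<le> r\<close> by (simp add: dist_norm)
  finally have "u \<bullet> (z + r *\<^sub>R u - x) \<le> 0"
    by (simp add: u_def mult_nonneg_nonpos)
  then have r: "r \<le> u \<bullet> (x - z)"
    using u by (simp add: inner_add_right inner_diff_right flip: power2_norm_eq_inner)
  have "(dist (x - a *\<^sub>R u) z)\<^sup>2 = (norm ((x - z) - a *\<^sub>R u))\<^sup>2"
    by (simp add: dist_norm diff_diff_eq add.commute)
  also have "\<dots> = (norm (x - z))\<^sup>2 - 2 * a * (u \<bullet> (x - z)) + a\<^sup>2 * (norm u)\<^sup>2"
    unfolding power2_norm_eq_inner
    by (simp add: inner_diff_left inner_diff_right inner_commute power2_eq_square algebra_simps)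
  also have "\<dots> \<le> (dist x z)\<^sup>2 - 2 * a * r + a\<^sup>2"
    using mult_left_mono[OF r \<open>0 \<le> a\<close>] u by (simp add: dist_norm)
  finally show ?thesis unfolding u_def .
qed

section \<open>A recursion driven by divergent step sizes\<close>

text \<open>As long as \<open>D\<close> stays above \<open>e\<close> it loses
  \<open>c * \<alpha> k\<close> at each step, which a nonnegative quantity starting below
  \<open>B\<close> cannot sustain up to \<open>K\<close>. Once below \<open>e\<close> it stays
  there: it either decreases or is at most \<open>h\<close> and is covered by the third premise.
  \<open>K\<close> is obtained before \<open>D\<close> and serves all such sequences.\<close>

lemma uniform_descent_index:
  fixes \<alpha> :: "nat \<Rightarrow> real"
  assumes "\<And>k. 0 < \<alpha> k" and div: "filterlim (\<lambda>n. \<Sum>k<n. \<alpha> k) at_top sequentially"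
    and "0 < c" "h \<le> e"
  obtains K where "\<And>D k. \<lbrakk>\<And>k. N \<le> k \<Longrightarrow> 0 \<le> D k; D N \<le> B;
      \<And>k. \<lbrakk>N \<le> k; D k \<le> h\<rbrakk> \<Longrightarrow> D (Suc k) \<le> e;
      \<And>k. \<lbrakk>N \<le> k; h \<le> D k\<rbrakk> \<Longrightarrow> D (Suc k) \<le> D k - c * \<alpha> k; K \<le> k\<rbrakk> \<Longrightarrow> D k \<le> (e::real)"
proof -
  \<comment> \<open>Makes \<open>c\<close> times the sum of \<open>\<alpha> k\<close> over
    \<open>N \<le> k < K\<close> exceed \<open>B\<close>.\<close>
  have "\<forall>\<^sub>F n in sequentially. B / c + (\<Sum>k<N. \<alpha> k) < (\<Sum>k<n. \<alpha> k)"
    using div by (simp add: filterlim_at_top_dense)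
  then obtain K where K: "N \<le> K" "B / c + (\<Sum>k<N. \<alpha> k) < (\<Sum>k<K. \<alpha> k)"
    unfolding eventually_sequentially by (metis max.cobounded1 max.cobounded2)
  show ?thesis
  proof (rule that[of K])
    fix D k
    assume nonneg: "\<And>k. N \<le> k \<Longrightarrow> 0 \<le> D k" and B: "D N \<le> B"
      and small: "\<And>k. \<lbrakk>N \<le> k; D k \<le> h\<rbrakk> \<Longrightarrow> D (Suc k) \<le> e"
      and large: "\<And>k. \<lbrakk>N \<le> k; h \<le> D k\<rbrakk> \<Longrightarrow> D (Suc k) \<le> D k - c * \<alpha> k" and "K \<le> k"
    have stay: "D (Suc k) \<le> e" if "N \<le> k" "D k \<le> e" for k
      using small[OF that(1)] large[OF that(1)] that(2) mult_pos_pos[OF \<open>0 < c\<close> assms(1)[of k]]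
      by linarith
    have "\<exists>j. N \<le> j \<and> j \<le> K \<and> D j \<le> e"
    proof (rule ccontr)
      assume no: "\<nexists>j. N \<le> j \<and> j \<le> K \<and> D j \<le> e"
      have "n \<le> K \<longrightarrow> D n \<le> D N - c * ((\<Sum>k<n. \<alpha> k) - (\<Sum>k<N. \<alpha> k))" if "N \<le> n" for n
        using that
      proof (induction n rule: dec_induct)
        case (step n)
        show ?case
        proof
          assume "Suc n \<le> K"
          then have "h \<le> D n" using no \<open>h \<le> e\<close> step.hyps by (meson Suc_leD linear order_trans)
          then show "D (Suc n) \<le> D N - c * ((\<Sum>k<Suc n. \<alpha> k) - (\<Sum>k<N. \<alpha> k))"
            using large[of n] step \<open>Suc n \<le> K\<close> by (simp add: algebra_simps)
        qed
      qed simp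
      then have "D K \<le> B - c * ((\<Sum>k<K. \<alpha> k) - (\<Sum>k<N. \<alpha> k))"
        using K(1) B by force
      also have "\<dots> < 0"
        using K(2) \<open>0 < c\<close> by (simp add: field_simps)
      finally show False using nonneg[OF K(1)] by simp
    qed
    then obtain j where j: "N \<le> j" "j \<le> K" "D j \<le> e" by blast
    have "j \<le> k" using j \<open>K \<le> k\<close> by simp
    then show "D k \<le> e"
    proof (induction k rule: dec_induct)
      case (step n)
      then show ?case using stay[of n] j by simp
    qed (use j in simp)
  qed
qed

section \<open>Convergence in distance to the solution set\<close>

lemma SOL_nonempty_closed:
  fixes D :: "'a::t2_space set" and \<phi> :: "'a \<Rightarrow> real"
  assumes "compact D" "D \<noteq> {}" "continuous_on D \<phi>"
  shows "SOL \<phi> D \<noteq> {} \<and> closed (SOL \<phi> D)"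
proof -
  obtain z where z: "z \<in> D" "\<forall>y\<in>D. \<phi> z \<le> \<phi> y"
    using continuous_attains_inf assms by blast
  then have "SOL \<phi> D = {x \<in> D. \<phi> x \<le> \<phi> z}"
    by (force simp: SOL_def)
  moreover have "closed {x \<in> D. \<phi> x \<le> \<phi> z}"
    using assms by (intro continuous_on_closed_Collect_le continuous_intros compact_imp_closed)
  ultimately show ?thesis using z by auto
qed

lemma SA_PSM_infdist_SOL_le:
  fixes C :: "nat \<Rightarrow> 'a::euclidean_space set" and \<phi> :: "'a \<Rightarrow> real"
  assumes C: "\<And>i. i \<in> {1..m} \<Longrightarrow> convex (C i) \<and> closed (C i)"
    and ne: "(\<Inter>i\<in>{1..m}. C i) \<noteq> {}"
    and bdd: "\<exists>s\<in>{1..m}. C s \<subseteq> cball 0 M"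
    and "0 < \<Delta>" "m \<le> q"
    and \<phi>: "continuous_on UNIV \<phi>"
    and \<alpha>: "\<And>k. 0 < \<alpha> k" "\<alpha> \<longlonglongrightarrow> 0"
    and div: "filterlim (\<lambda>n. \<Sum>k<n. \<alpha> k) at_top sequentially"
    and "0 < \<epsilon>"
  obtains K where "\<And>\<Omega> w x k. \<lbrakk>SA_PSM C m \<Delta> q \<phi> \<alpha> \<Omega> w x;
      \<And>k. 1 \<le> k \<Longrightarrow> (\<Omega> k, w k) \<in> M_star_star C m M \<Delta> q; K \<le> k\<rbrakk>
    \<Longrightarrow> infdist (x k) (SOL \<phi> (\<Inter>i\<in>{1..m}. C i)) \<le> \<epsilon>"
proof -
  define D where "D = (\<Inter>i\<in>{1..m}. C i)"
  define S where "S = SOL \<phi> D"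
  have m: "0 < m" and q: "0 < q" using bdd \<open>m \<le> q\<close> by auto
  have D_sub: "D \<subseteq> cball 0 M" using bdd by (auto simp: D_def)
  have D_closed: "closed D" unfolding D_def using C by auto
  have "compact D"
    using D_closed D_sub by (meson bounded_cball bounded_subset compact_eq_bounded_closed)
  then have S_ne: "S \<noteq> {}" and S_closed: "closed S"
    using SOL_nonempty_closed[of D \<phi>] ne continuous_on_subset[OF \<phi>] by (auto simp: S_def D_def)
  have S_D: "S \<subseteq> D" by (auto simp: S_def SOL_def)
  obtain z0 where z0: "z0 \<in> S" using S_ne by blast
  then have z0_D: "z0 \<in> D" using S_D by blast
  have S_min: "\<phi> z \<le> \<phi> y" if "z \<in> S" "y \<in> D" for y z
    using that by (simp add: S_def SOL_def)
  have z0_norm: "norm z0 \<le> M" using z0_D D_sub by auto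
  then have M: "0 \<le> M" using norm_ge_zero[of z0] by linarith
  have CD: "convex (C i) \<and> closed (C i) \<and> z \<in> C i" if "i \<in> {1..m}" "z \<in> D" for i z
    using C that by (auto simp: D_def)

  \<comment> \<open>\<open>?X\<close> will contain the iterates from index 2 on, \<open>?Y\<close>
    also the points reached from them by a step of length at most 1.\<close>
  let ?X = "cball z0 (2 * M)" and ?Y = "cball z0 (2 * M + 1)"
  obtain \<eta> where \<eta>: "0 < \<eta>"
    "\<And>x. \<lbrakk>x \<in> ?X; \<epsilon> / 2 \<le> infdist x S\<rbrakk> \<Longrightarrow> \<eta> \<le> infdist x D \<or> \<phi> z0 + \<eta> \<le> \<phi> x"
    using SOL_dist_dichotomy[of ?X D \<phi> z0 "\<epsilon> / 2"] D_closed continuous_on_subset[OF \<phi>]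
      z0 \<open>0 < \<epsilon>\<close> unfolding S_def by (metis compact_cball half_gt_zero top_greatest)
  \<comment> \<open>Yields one radius \<open>r\<close> for all \<open>z\<close> in \<open>S\<close>:
    if \<open>\<phi> (x k)\<close> exceeds the minimum by \<open>\<eta>\<close>, the ball of radius
    \<open>r\<close> around \<open>z\<close> lies in the sublevel set of \<open>x k\<close>, as
    \<open>dist_subgradient_step_le\<close> demands.\<close>
  have "uniformly_continuous_on (cball 0 (M + 1)) \<phi>"
    by (intro compact_uniformly_continuous continuous_on_subset[OF \<phi>]) auto
  then obtain r' where r': "0 < r'"
    "\<And>y z. \<lbrakk>y \<in> cball 0 (M + 1); z \<in> cball 0 (M + 1); dist y z < r'\<rbrakk> \<Longrightarrow> dist (\<phi> y) (\<phi> z) < \<eta>"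
    unfolding uniformly_continuous_on_def using \<eta>(1) by (metis dist_commute)
  \<comment> \<open>Halving \<open>r'\<close> allows for the non-strict bound in
    \<open>r_ball\<close>; the cap 1 keeps that ball inside \<open>cball 0 (M + 1)\<close>.\<close>
  define r where "r = min (r' / 2) 1"
  have r: "0 < r" "r \<le> 1" "r < r'" using r' by (auto simp: r_def)
  have r_ball: "\<phi> y \<le> \<phi> z0 + \<eta>" if "z \<in> S" "dist y z \<le> r" for y z
  proof -
    have "z \<in> cball 0 M" using that S_D D_sub by blast
    moreover have "norm y \<le> norm z + dist y z"
      using norm_triangle_sub[of y z] by (simp add: dist_norm)
    ultimately have "dist (\<phi> y) (\<phi> z) < \<eta>"
      using that r by (intro r'(2)) auto
    moreover have "\<phi> z \<le> \<phi> z0" using that z0_D by (intro S_min)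
    ultimately show ?thesis by (simp add: dist_real_def)
  qed
  \<comment> \<open>The averaging acts after the subgradient step, which may bring a point at
    distance \<open>\<eta>\<close> from \<open>D\<close> closer by up to
    \<open>\<eta> / 2\<close>.\<close>
  obtain \<gamma> where \<gamma>: "0 < \<gamma>"
    "\<And>\<Omega> w x z. \<lbrakk>(\<Omega>, w) \<in> M_star m \<Delta> q; x \<in> ?Y; z \<in> D; \<eta> / 2 \<le> infdist x D\<rbrakk>
        \<Longrightarrow> (dist (string_average C \<Omega> w x) z)\<^sup>2 + \<gamma> \<le> (dist x z)\<^sup>2"
    using string_average_decrease[OF C ne \<open>0 < \<Delta>\<close> q m compact_cball, of "\<eta> / 2" z0 "2 * M + 1"] \<eta>(1)
    unfolding D_def by auto
  have nonexp: "(dist (string_average C \<Omega> w x) z)\<^sup>2 \<le> (dist x z)\<^sup>2"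
    if "(\<Omega>, w) \<in> M_star m \<Delta> q" "z \<in> D" for \<Omega> w x z
  proof -
    have "1 \<in> {1..m}" using m by simp
    then have "(dist (string_average C \<Omega> w x) z)\<^sup>2 + \<Delta> * (infdist x (C 1))\<^sup>2 / real q \<le> (dist x z)\<^sup>2"
      using CD that \<open>0 < \<Delta>\<close> by (intro string_average_Fejer) auto
    moreover have "0 \<le> \<Delta> * (infdist x (C 1))\<^sup>2 / real q" using \<open>0 < \<Delta>\<close> by simp
    ultimately show ?thesis by linarith
  qed

  \<comment> \<open>\<open>r\<close> gives \<open>(\<alpha> k)^2 \<le> r * \<alpha> k\<close>,
    \<open>\<eta> / 2\<close> preserves infeasibility, \<open>\<epsilon> / 2\<close> limits the
    growth near \<open>S\<close>. With the last bound \<open>\<gamma>\<close> absorbs the growth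
    \<open>(8 * M + 1) * \<alpha> k\<close> and still leaves a decrease of
    \<open>\<alpha> k\<close>.\<close>
  define a0 where "a0 = Min {r, \<eta> / 2, \<epsilon> / 2, \<gamma> / (8 * M + 2)}"
  have "0 < a0" using r \<eta>(1) \<gamma>(1) \<open>0 < \<epsilon>\<close> M by (simp add: a0_def)
  then have "\<forall>\<^sub>F k in sequentially. \<alpha> k < a0"
    using \<alpha>(2) order_tendstoD(2) by blast
  then obtain N0 where N0: "\<And>k. N0 \<le> k \<Longrightarrow> \<alpha> k < a0"
    unfolding eventually_sequentially by blast
  \<comment> \<open>The pairs are \<open>M\<close>-fit from index 1 on, so \<open>x 2\<close> is the
    first iterate guaranteed to lie in \<open>?X\<close>.\<close>
  define N where "N = max 2 N0"
  have small: "\<alpha> k \<le> r" "\<alpha> k \<le> \<eta> / 2" "\<alpha> k \<le> \<epsilon> / 2" "(8 * M + 2) * \<alpha> k \<le> \<gamma>" if "N \<le> k" for k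
  proof -
    have "\<alpha> k < a0" using N0 that by (simp add: N_def)
    then have "\<alpha> k \<le> \<gamma> / (8 * M + 2)" and *: "\<alpha> k \<le> r" "\<alpha> k \<le> \<eta> / 2" "\<alpha> k \<le> \<epsilon> / 2"
      by (auto simp: a0_def)
    then show "(8 * M + 2) * \<alpha> k \<le> \<gamma>"
      using M by (simp add: pos_le_divide_eq mult.commute)
    show "\<alpha> k \<le> r" "\<alpha> k \<le> \<eta> / 2" "\<alpha> k \<le> \<epsilon> / 2" by (fact *)+
  qed

  \<comment> \<open>The recursion is meant for the squared distance to \<open>S\<close>. The initial
    bound adds \<open>2 * M\<close> from the iterate to \<open>z0\<close> and \<open>2 * M\<close>
    for the diameter of \<open>S\<close>.\<close>
  have "(\<epsilon> / 2)\<^sup>2 \<le> \<epsilon>\<^sup>2" using \<open>0 < \<epsilon>\<close> by (intro power_mono) auto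
  with \<alpha>(1) div r(1) obtain K where K: "\<And>d k. \<lbrakk>\<And>k. N \<le> k \<Longrightarrow> 0 \<le> d k; d N \<le> (4 * M)\<^sup>2;
      \<And>k. \<lbrakk>N \<le> k; d k \<le> (\<epsilon> / 2)\<^sup>2\<rbrakk> \<Longrightarrow> d (Suc k) \<le> \<epsilon>\<^sup>2;
      \<And>k. \<lbrakk>N \<le> k; (\<epsilon> / 2)\<^sup>2 \<le> d k\<rbrakk> \<Longrightarrow> d (Suc k) \<le> d k - r * \<alpha> k; K \<le> k\<rbrakk> \<Longrightarrow> d k \<le> \<epsilon>\<^sup>2"
    by (rule uniform_descent_index[where N = N and B = "(4 * M)\<^sup>2"]) blast
  show thesis
  proof (rule that)
    fix \<Omega> w x k
    assume seq: "SA_PSM C m \<Delta> q \<phi> \<alpha> \<Omega> w x"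
      and star: "\<And>k. 1 \<le> k \<Longrightarrow> (\<Omega> k, w k) \<in> M_star_star C m M \<Delta> q" and k: "K \<le> k"
    have Mstar: "(\<Omega> k, w k) \<in> M_star m \<Delta> q" for k
      using seq by (simp add: SA_PSM_def)
    \<comment> \<open>Merges both branches of the method: \<open>y\<close> is the point to which the
      averaging is applied, at distance at most \<open>\<alpha> k\<close> from \<open>x k\<close> in
      either case.\<close>
    define step where "step k y \<longleftrightarrow> x (Suc k) = string_average C (\<Omega> k) (w k) y \<and>
      (0 \<in> subdifferential \<phi> (x k) \<and> y = x k \<or> (\<exists>s \<in> subdifferential \<phi> (x k).
         s \<noteq> 0 \<and> y = x k - \<alpha> k *\<^sub>R (s /\<^sub>R norm s)))" for k y
    have "\<exists>y. step k y" for k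
    proof (cases "0 \<in> subdifferential \<phi> (x k)")
      case True
      then show ?thesis using seq by (intro exI[of _ "x k"]) (simp add: step_def SA_PSM_def)
    next
      case False
      then obtain s where s: "s \<in> subdifferential \<phi> (x k)"
        "x (Suc k) = string_average C (\<Omega> k) (w k) (x k - \<alpha> k *\<^sub>R (s /\<^sub>R norm s))"
        using seq unfolding SA_PSM_def by meson
      moreover have "s \<noteq> 0" using s(1) False by auto
      ultimately have "step k (x k - \<alpha> k *\<^sub>R (s /\<^sub>R norm s))"
        unfolding step_def by blast
      then show ?thesis by blast
    qed
    then obtain y where "\<And>k. step k (y k)" by metis
    note y = this[unfolded step_def]
    have xy: "dist (y k) (x k) \<le> \<alpha> k" for k
      using y[of k] \<alpha>(1)[of k] by (auto simp: dist_norm)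
    have xX: "x k \<in> ?X" if "2 \<le> k" for k
    proof -
      obtain j where j: "k = Suc j" "1 \<le> j" using \<open>2 \<le> k\<close> by (cases k) auto
      then show ?thesis
        using dist_string_average_M_fit_le[OF CD[OF _ z0_D] star[OF j(2)] z0_norm, of "y j"] y[of j]
        by (simp add: dist_commute)
    qed
    have dist_S: "dist (x k) z \<le> 4 * M" if "2 \<le> k" "z \<in> S" for k z
    proof -
      have "norm z \<le> M" using that S_D D_sub by force
      then have "dist z0 z \<le> 2 * M"
        using z0_norm norm_triangle_ineq4[of z0 z] by (simp add: dist_norm)
      then show ?thesis
        using xX[OF that(1)] dist_triangle[of "x k" z z0] by (simp add: dist_commute)
    qed
    have decrease: "(dist (x (Suc k)) z)\<^sup>2 \<le> (dist (x k) z)\<^sup>2 - r * \<alpha> k"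
      if k: "N \<le> k" and far: "\<epsilon> / 2 \<le> infdist (x k) S" and z: "z \<in> S" for k z
    proof -
      have k2: "2 \<le> k" using k by (simp add: N_def)
      have zD: "z \<in> D" using z S_D by blast
      have step: "(dist (x (Suc k)) z)\<^sup>2 \<le> (dist (y k) z)\<^sup>2"
        using nonexp[OF Mstar zD] y by simp
      consider "\<eta> \<le> infdist (x k) D" | "\<phi> z0 + \<eta> \<le> \<phi> (x k)"
        using \<eta>(2)[OF xX[OF k2] far] by blast
      then show ?thesis
      proof cases
        case 1
        have "infdist (x k) D \<le> infdist (y k) D + \<alpha> k"
          using infdist_triangle[of "x k" D "y k"] xy[of k] by (simp add: dist_commute)
        then have "\<eta> / 2 \<le> infdist (y k) D"
          using 1 small(2)[OF k] by linarith
        moreover have "y k \<in> ?Y"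
          using xX[OF k2] xy[of k] dist_triangle[of z0 "y k" "x k"] small(1)[OF k] r(2)
          by (simp add: dist_commute)
        ultimately have "(dist (x (Suc k)) z)\<^sup>2 + \<gamma> \<le> (dist (y k) z)\<^sup>2"
          using \<gamma>(2)[OF Mstar _ zD] y by simp
        also have "\<dots> \<le> (dist (x k) z + \<alpha> k)\<^sup>2"
          using dist_triangle[of "y k" z "x k"] xy[of k] by (intro power_mono) auto
        also have "\<dots> = (dist (x k) z)\<^sup>2 + (2 * dist (x k) z + \<alpha> k) * \<alpha> k"
          by (simp add: power2_eq_square algebra_simps)
        also have "(2 * dist (x k) z + \<alpha> k) * \<alpha> k \<le> (8 * M + 1) * \<alpha> k"
          using dist_S[OF k2 z] small(1)[OF k] r(2) \<alpha>(1)[of k] by (intro mult_right_mono) auto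
        finally have "(dist (x (Suc k)) z)\<^sup>2 + \<gamma> \<le> (dist (x k) z)\<^sup>2 + (8 * M + 1) * \<alpha> k"
          by simp
        moreover have "r * \<alpha> k \<le> \<alpha> k" using r(2) \<alpha>(1)[of k] by simp
        ultimately show ?thesis
          using small(4)[OF k] by (simp add: algebra_simps)
      next
        case 2
        \<comment> \<open>\<open>z0\<close> has a smaller value, so \<open>x k\<close> does not
          minimize \<open>\<phi>\<close> and a genuine subgradient step is taken.\<close>
        have "0 \<notin> subdifferential \<phi> (x k)"
          using 2 \<eta>(1) by (auto simp: subdifferential_def intro!: exI[of _ z0])
        then obtain s where s: "s \<in> subdifferential \<phi> (x k)" "s \<noteq> 0"
            "y k = x k - \<alpha> k *\<^sub>R (s /\<^sub>R norm s)"
          using y[of k] by blast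
        have "(dist (y k) z)\<^sup>2 \<le> (dist (x k) z)\<^sup>2 - 2 * \<alpha> k * r + (\<alpha> k)\<^sup>2"
          unfolding s(3) using \<alpha>(1)[of k] r(1) r_ball[OF z] 2
          by (intro dist_subgradient_step_le[OF s(1,2)]) (auto intro: order_trans)
        moreover have "(\<alpha> k)\<^sup>2 \<le> r * \<alpha> k"
          using small(1)[OF k] \<alpha>(1)[of k] by (simp add: power2_eq_square mult_right_mono)
        moreover have "2 * \<alpha> k * r = 2 * (r * \<alpha> k)" by simp
        ultimately show ?thesis using step by linarith
      qed
    qed
    have "(infdist (x k) S)\<^sup>2 \<le> \<epsilon>\<^sup>2"
    proof (rule K[where d = "\<lambda>k. (infdist (x k) S)\<^sup>2", OF _ _ _ _ k])
      obtain z where "z \<in> S" using S_ne by blast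
      have "infdist (x N) S \<le> 4 * M"
        using dist_S[of N z] infdist_le[OF \<open>z \<in> S\<close>, of "x N"] \<open>z \<in> S\<close> by (simp add: N_def)
      then show "(infdist (x N) S)\<^sup>2 \<le> (4 * M)\<^sup>2"
        by (intro power_mono infdist_nonneg)
    next
      fix k assume k: "N \<le> k" and sq: "(infdist (x k) S)\<^sup>2 \<le> (\<epsilon> / 2)\<^sup>2"
      from sq have near: "infdist (x k) S \<le> \<epsilon> / 2"
        by (rule power2_le_imp_le) (use \<open>0 < \<epsilon>\<close> in simp)
      obtain z where z: "z \<in> S" "infdist (x k) S = dist (x k) z"
        using infdist_attains_inf[OF S_closed S_ne] by blast
      have "infdist (x (Suc k)) S \<le> dist (x (Suc k)) z"
        using z(1) by (rule infdist_le)
      also have "\<dots> \<le> dist (y k) z"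
        using nonexp[OF Mstar, of z k "y k"] z(1) S_D y[of k] by (auto intro: power2_le_imp_le)
      also have "\<dots> \<le> \<epsilon>"
        using dist_triangle[of "y k" z "x k"] xy[of k] small(3)[OF k] near z(2) by simp
      finally show "(infdist (x (Suc k)) S)\<^sup>2 \<le> \<epsilon>\<^sup>2"
        by (intro power_mono infdist_nonneg)
    next
      fix k assume k: "N \<le> k" and sq: "(\<epsilon> / 2)\<^sup>2 \<le> (infdist (x k) S)\<^sup>2"
      from sq have far: "\<epsilon> / 2 \<le> infdist (x k) S"
        by (rule power2_le_imp_le) (rule infdist_nonneg)
      obtain z where z: "z \<in> S" "infdist (x k) S = dist (x k) z"
        using infdist_attains_inf[OF S_closed S_ne] by blast
      have "(infdist (x (Suc k)) S)\<^sup>2 \<le> (dist (x (Suc k)) z)\<^sup>2"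
        using z(1) by (intro power_mono infdist_le infdist_nonneg)
      then show "(infdist (x (Suc k)) S)\<^sup>2 \<le> (infdist (x k) S)\<^sup>2 - r * \<alpha> k"
        using decrease[OF k far z(1)] z(2) by simp
    qed simp
    then have "infdist (x k) S \<le> \<epsilon>"
      by (rule power2_le_imp_le) (use \<open>0 < \<epsilon>\<close> in simp)
    then show "infdist (x k) (SOL \<phi> (\<Inter>i\<in>{1..m}. C i)) \<le> \<epsilon>"
      by (simp add: S_def D_def)
  qed
qed

section \<open>Distance and objective estimates\<close>

theorem theorem9:
  fixes m qbar :: nat
    and C :: "nat \<Rightarrow> (real ^ 'n) set"
    and \<phi> :: "real ^ 'n \<Rightarrow> real"
    and \<alpha> :: "nat \<Rightarrow> real"
    and M \<Delta> \<epsilon> :: real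
  assumes "\<And>i. i \<in> {1..m} \<Longrightarrow> C i \<noteq> {} \<and> closed (C i) \<and> convex (C i)"
    and "(\<Inter>i\<in>{1..m}. C i) \<noteq> {}"
    and "0 < M"
    and "\<exists>s\<in>{1..m}. C s \<subseteq> cball 0 M"
    and "0 < \<Delta>" "\<Delta> < 1 / real m"
    and "m \<le> qbar"
    and "convex_on UNIV \<phi>"
    and "\<And>k. 0 < \<alpha> k \<and> \<alpha> k \<le> 1"
    and "\<alpha> \<longlonglongrightarrow> 0"
    and "filterlim (\<lambda>n. \<Sum>k<n. \<alpha> k) at_top sequentially"
    and "0 < \<epsilon>" "\<epsilon> < 1"
  shows "\<exists>(K::nat) (L::real). \<forall>\<Omega> w x.
           SA_PSM C m \<Delta> qbar \<phi> \<alpha> \<Omega> w x \<and>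
           (\<forall>k\<ge>1. (\<Omega> k, w k) \<in> M_star_star C m M \<Delta> qbar) \<longrightarrow>
           (\<forall>k\<ge>K.
              infdist (x k) (SOL \<phi> (\<Inter>i\<in>{1..m}. C i)) \<le> \<epsilon> \<and>
              \<phi> (x k) \<le> Inf (\<phi> ` SOL \<phi> (\<Inter>i\<in>{1..m}. C i)) + \<epsilon> * L)"
proof -
  define D where "D = (\<Inter>i\<in>{1..m}. C i)"
  have cont: "continuous_on UNIV \<phi>"
    using assms(8) by (intro convex_on_continuous) auto
  have D_sub: "D \<subseteq> cball 0 M" using assms(4) by (auto simp: D_def)
  have D_closed: "closed D" unfolding D_def using assms(1) by auto
  have "compact D"
    using D_closed D_sub by (meson bounded_cball bounded_subset compact_eq_bounded_closed)
  then have ne: "SOL \<phi> D \<noteq> {}" and closed: "closed (SOL \<phi> D)"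
    using SOL_nonempty_closed[of D \<phi>] assms(2) continuous_on_subset[OF cont] by (auto simp: D_def)
  have "uniformly_continuous_on (cball 0 (M + 1)) \<phi>"
    by (intro compact_uniformly_continuous continuous_on_subset[OF cont]) auto
  then obtain r where r: "0 < r"
    "\<And>y z. \<lbrakk>y \<in> cball 0 (M + 1); z \<in> cball 0 (M + 1); dist y z < r\<rbrakk> \<Longrightarrow> dist (\<phi> y) (\<phi> z) < \<epsilon>"
    unfolding uniformly_continuous_on_def using assms(12) by (metis dist_commute)
  \<comment> \<open>\<open>\<epsilon>\<close> serves the distance estimate, \<open>r / 2\<close> the
    objective. As \<open>\<delta> \<le> \<epsilon> < 1\<close>, points within
    \<open>\<delta>\<close> of a solution lie in \<open>cball 0 (M + 1)\<close>.\<close>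
  define \<delta> where "\<delta> = min \<epsilon> (r / 2)"
  have \<delta>: "0 < \<delta>" "\<delta> \<le> \<epsilon>" "\<delta> < r" using r(1) assms(12) by (auto simp: \<delta>_def)
  have C: "convex (C i) \<and> closed (C i)" if "i \<in> {1..m}" for i
    using assms(1)[OF that] by simp
  have pos: "0 < \<alpha> k" for k using assms(9) by simp
  obtain K where K: "\<And>\<Omega> w x k. \<lbrakk>SA_PSM C m \<Delta> qbar \<phi> \<alpha> \<Omega> w x;
      \<And>k. 1 \<le> k \<Longrightarrow> (\<Omega> k, w k) \<in> M_star_star C m M \<Delta> qbar; K \<le> k\<rbrakk>
    \<Longrightarrow> infdist (x k) (SOL \<phi> D) \<le> \<delta>"
    using SA_PSM_infdist_SOL_le[OF C assms(2,4,5,7) cont pos assms(10,11) \<delta>(1)]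
    unfolding D_def by blast
  have val: "\<phi> x \<le> Inf (\<phi> ` SOL \<phi> D) + \<epsilon> * 1" if x: "infdist x (SOL \<phi> D) \<le> \<delta>" for x
  proof -
    obtain z where z: "z \<in> SOL \<phi> D" "infdist x (SOL \<phi> D) = dist x z"
      using infdist_attains_inf[OF closed ne] by blast
    have "z \<in> cball 0 M" using z(1) D_sub by (auto simp: SOL_def)
    moreover have "norm x \<le> norm z + dist x z"
      using norm_triangle_sub[of x z] by (simp add: dist_norm)
    ultimately have "dist (\<phi> x) (\<phi> z) < \<epsilon>"
      using x z(2) \<delta> assms(13) by (intro r(2)) auto
    \<comment> \<open>\<open>\<phi>\<close> is constant on the solution set, so the infimum is its
      value at the nearest solution \<open>z\<close>.\<close>
    moreover have "\<phi> ` SOL \<phi> D = {\<phi> z}"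
      using z(1) by (force simp: SOL_def intro: order_antisym)
    ultimately show ?thesis by (simp add: dist_real_def)
  qed
  show ?thesis
    using K val \<delta>(2) unfolding D_def by (intro exI[of _ K] exI[of _ 1]) (meson order_trans)
qed

end
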